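(* The transience class of the Abelian sandpile model on the $n \times n$ grid $\square_n$ satisfies $\mathrm{tcl}(\square_n) = \Omega(n^{4})$ as $n\to\infty$.
   Context: The graph $\square_n$ has vertex set $\{1,\dots,n\}^2 \cup \{s\}$, where $s$ is a sink vertex. Two non-sink vertices are joined by an edge if they differ by exactly $1$ in exactly one coordinate. Each boundary vertex is joined to $s$ by additional (possibly parallel) edges so that every non-sink vertex has degree exactly $4$. Abelian sandpile model on a finite multigraph $G$ with sink $s$: a configuration assigns a nonnegative integer number of grains $\sigma(v)$ to each non-sink vertex $v$. A non-sink vertex $v$ with $\sigma(v)\ge \deg(v)$ may topple, sending one grain along each incident edge; grains sent to $s$ disappear. A configuration in which no vertex can topple is stable. Repeated toppling always terminates, and the resulting stable configuration does not depend on the order of topplings. One step of the process adds one grain at a chosen non-sink vertex and then stabilizes. A stable configuration is recurrent if it can be revisited by this process; otherwise it is transient. The transience class $\mathrm{tcl}(G)$ is the maximum number of grains that can be added, one at a time at adversarially chosen non-sink vertices and stabilizing after each addition, starting from the empty (all-zero) configuration, before the configuration necessarily becomes recurrent. *)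

theory Defs
  imports Complex_Main "HOL-Library.Landau_Symbols"
begin

text \<open>
  A loopless undirected multigraph with a distinguished sink; \<open>mult G u v\<close> is the number of
  parallel edges joining \<open>u\<close> and \<open>v\<close>.
\<close>

record 'v sink_graph =
  verts :: "'v set"
  mult :: "'v \<Rightarrow> 'v \<Rightarrow> nat"
  sink :: 'v

definition sink_graph_wf :: "'v sink_graph \<Rightarrow> bool" where
  "sink_graph_wf G \<longleftrightarrow> finite (verts G) \<and> sink G \<in> verts G \<and>
     (\<forall>u v. mult G u v = mult G v u) \<and> (\<forall>v. mult G v v = 0) \<and>
     (\<forall>u v. mult G u v \<noteq> 0 \<longrightarrow> u \<in> verts G \<and> v \<in> verts G)"

definition nonsink :: "'v sink_graph \<Rightarrow> 'v set" where
  "nonsink G = verts G - {sink G}"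

definition deg :: "'v sink_graph \<Rightarrow> 'v \<Rightarrow> nat" where
  "deg G v = (\<Sum>w\<in>verts G. mult G v w)"

text \<open>
  Configurations are total functions that vanish outside the non-sink vertices. In particular,
  grains sent to the sink are discarded by \<open>topple\<close>.
\<close>

definition is_config :: "'v sink_graph \<Rightarrow> ('v \<Rightarrow> nat) \<Rightarrow> bool" where
  "is_config G \<sigma> \<longleftrightarrow> (\<forall>v. v \<notin> nonsink G \<longrightarrow> \<sigma> v = 0)"

definition stable :: "'v sink_graph \<Rightarrow> ('v \<Rightarrow> nat) \<Rightarrow> bool" where
  "stable G \<sigma> \<longleftrightarrow> (\<forall>v\<in>nonsink G. \<sigma> v < deg G v)"

definition topple :: "'v sink_graph \<Rightarrow> 'v \<Rightarrow> ('v \<Rightarrow> nat) \<Rightarrow> 'v \<Rightarrow> nat" where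
  "topple G v \<sigma> = (\<lambda>w.
     if w = v then \<sigma> w - deg G v
     else if w \<in> nonsink G then \<sigma> w + mult G v w
     else \<sigma> w)"

inductive topple_step :: "'v sink_graph \<Rightarrow> ('v \<Rightarrow> nat) \<Rightarrow> ('v \<Rightarrow> nat) \<Rightarrow> bool" for G where
  "v \<in> nonsink G \<Longrightarrow> deg G v \<le> \<sigma> v \<Longrightarrow> topple_step G \<sigma> (topple G v \<sigma>)"

definition stabilizes_to :: "'v sink_graph \<Rightarrow> ('v \<Rightarrow> nat) \<Rightarrow> ('v \<Rightarrow> nat) \<Rightarrow> bool" where
  "stabilizes_to G \<sigma> \<tau> \<longleftrightarrow> (topple_step G)\<^sup>*\<^sup>* \<sigma> \<tau> \<and> stable G \<tau>"

text \<open>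
  \<open>adds G \<sigma> vs \<tau>\<close>: starting from \<open>\<sigma>\<close>, dropping single grains at the vertices listed
  in \<open>vs\<close>, from left to right, and stabilizing after each grain leads to \<open>\<tau>\<close>.
\<close>

inductive adds :: "'v sink_graph \<Rightarrow> ('v \<Rightarrow> nat) \<Rightarrow> 'v list \<Rightarrow> ('v \<Rightarrow> nat) \<Rightarrow> bool" for G where
  adds_Nil: "adds G \<sigma> [] \<sigma>"
| adds_Cons: "v \<in> nonsink G \<Longrightarrow> stabilizes_to G (\<sigma>(v := \<sigma> v + 1)) \<rho> \<Longrightarrow> adds G \<rho> vs \<tau>
    \<Longrightarrow> adds G \<sigma> (v # vs) \<tau>"

definition recurrent :: "'v sink_graph \<Rightarrow> ('v \<Rightarrow> nat) \<Rightarrow> bool" where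
  "recurrent G \<sigma> \<longleftrightarrow> is_config G \<sigma> \<and> stable G \<sigma> \<and> (\<exists>vs. vs \<noteq> [] \<and> adds G \<sigma> vs \<sigma>)"

definition transient :: "'v sink_graph \<Rightarrow> ('v \<Rightarrow> nat) \<Rightarrow> bool" where
  "transient G \<sigma> \<longleftrightarrow> is_config G \<sigma> \<and> stable G \<sigma> \<and> \<not> recurrent G \<sigma>"

text \<open>
  For a finite graph the supremum below is a maximum whenever every non-sink vertex is connected to the sink: a
  transient configuration is never revisited and every configuration preceding it is transient, so
  the length of an admissible sequence is less than the number of stable configurations. The
  supremum of the empty set of naturals, which is \<open>0\<close>, covers the case that the empty
  configuration is already recurrent.
\<close>

definition tcl :: "'v sink_graph \<Rightarrow> nat" where
  "tcl G = Sup {length vs |vs. \<exists>\<tau>. adds G (\<lambda>_. 0) vs \<tau> \<and> transient G \<tau>}"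

definition cells :: "nat \<Rightarrow> (nat \<times> nat) set" where
  "cells n = {1..n} \<times> {1..n}"

definition differ_by_1 :: "nat \<Rightarrow> nat \<Rightarrow> bool" where
  "differ_by_1 a b \<longleftrightarrow> a = b + 1 \<or> b = a + 1"

definition cell_adj :: "nat \<Rightarrow> nat \<times> nat \<Rightarrow> nat \<times> nat \<Rightarrow> bool" where
  "cell_adj n p q \<longleftrightarrow> p \<in> cells n \<and> q \<in> cells n \<and>
     (fst p = fst q \<and> differ_by_1 (snd p) (snd q) \<or>
      snd p = snd q \<and> differ_by_1 (fst p) (fst q))"

definition sink_edges :: "nat \<Rightarrow> nat \<times> nat \<Rightarrow> nat" where
  "sink_edges n p = (if p \<in> cells n then 4 - card {q. cell_adj n p q} else 0)"

text \<open>In the grid graph the sink is \<^term>\<open>None\<close> and the cells are \<^term>\<open>Some p\<close>.\<close>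

fun grid_mult :: "nat \<Rightarrow> (nat \<times> nat) option \<Rightarrow> (nat \<times> nat) option \<Rightarrow> nat" where
  "grid_mult n (Some p) (Some q) = (if cell_adj n p q then 1 else 0)"
| "grid_mult n (Some p) None = sink_edges n p"
| "grid_mult n None (Some q) = sink_edges n q"
| "grid_mult n None None = 0"

definition grid :: "nat \<Rightarrow> (nat \<times> nat) option sink_graph" where
  "grid n = \<lparr>verts = insert None (Some ` cells n), mult = grid_mult n, sink = None\<rparr>"

lemma cell_adj_sym: "cell_adj n p q = cell_adj n q p"
  by (auto simp: cell_adj_def differ_by_1_def)

lemma cell_adj_irrefl: "\<not> cell_adj n p p"
  by (auto simp: cell_adj_def differ_by_1_def)

lemma finite_cells: "finite (cells n)"
  by (simp add: cells_def)

lemma card_cell_adj_le: "card {q. cell_adj n p q} \<le> 4"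
proof -
  obtain i j where p: "p = (i, j)" by (cases p)
  have "{q. cell_adj n p q} \<subseteq> set [(i + 1, j), (i - 1, j), (i, j + 1), (i, j - 1)]"
    by (auto simp: p cell_adj_def differ_by_1_def)
  then have "card {q. cell_adj n p q} \<le> card (set [(i + 1, j), (i - 1, j), (i, j + 1), (i, j - 1)])"
    by (rule card_mono[OF finite_set])
  also have "\<dots> \<le> 4"
    by (rule order_trans[OF card_length]) simp
  finally show ?thesis .
qed

lemma grid_wf: "sink_graph_wf (grid n)"
proof -
  have "grid_mult n u v = grid_mult n v u" for u v
    by (cases u; cases v) (auto simp: cell_adj_sym)
  moreover have "grid_mult n v v = 0" for v
    by (cases v) (auto simp: cell_adj_irrefl)
  moreover have "grid_mult n u v \<noteq> 0 \<Longrightarrow> u \<in> insert None (Some ` cells n) \<and> v \<in> insert None (Some ` cells n)" for u v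
    by (cases u; cases v) (auto simp: cell_adj_def sink_edges_def split: if_splits)
  ultimately show ?thesis
    unfolding sink_graph_wf_def grid_def by (simp add: finite_cells) blast
qed

lemma deg_grid: "v \<in> nonsink (grid n) \<Longrightarrow> deg (grid n) v = 4"
proof -
  assume "v \<in> nonsink (grid n)"
  then obtain p where v: "v = Some p" and p: "p \<in> cells n"
    by (auto simp: nonsink_def grid_def)
  have eq: "cells n \<inter> {q. cell_adj n p q} = {q. cell_adj n p q}"
    by (auto simp: cell_adj_def)
  have "deg (grid n) v = sink_edges n p + (\<Sum>q\<in>cells n. if cell_adj n p q then 1 else 0)"
    by (simp add: deg_def grid_def v finite_cells sum.reindex)
  also have "(\<Sum>q\<in>cells n. if cell_adj n p q then 1 else 0) = card {q. cell_adj n p q}"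
    by (simp add: sum.If_cases finite_cells eq)
  finally show ?thesis
    using card_cell_adj_le[of n p] p by (simp add: sink_edges_def)
qed

end

theory Submission
  imports Defs "HOL-Library.Confluence"
begin

text \<open>
  Drop all grains at the corner \<open>(n, n)\<close>. For a nonnegative superharmonic function \<open>\<phi>\<close> (zero
  outside the grid) the potential \<open>\<Sum>v. \<sigma> v * \<phi> v\<close> never increases under toppling, and it drops by
  \<open>laplacian \<phi> v\<close> whenever \<open>v\<close> topples. There is such a \<open>\<phi>\<close> with \<open>\<phi> (n, n) = O(1 / n ^ 4)\<close> whose
  Laplacian is bounded away from \<open>0\<close> near the opposite corner \<open>(1, 1)\<close>, so as long as fewer than a
  small multiple of \<open>n ^ 4\<close> grains are dropped, no vertex near \<open>(1, 1)\<close> topples. Then \<open>(1, 1)\<close> and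
  \<open>(1, 2)\<close> are both empty, which is impossible in a recurrent configuration: to revisit it, every
  vertex would have to topple, and two adjacent vertices that have toppled are never both empty.
\<close>

section \<open>Stabilization and recurrence\<close>

definition terminating :: "'v sink_graph \<Rightarrow> bool" where
  "terminating G \<longleftrightarrow> wfp (\<lambda>\<tau> \<sigma>. topple_step G \<sigma> \<tau>)"

section \<open>Commuting topplings and unique stabilization\<close>

lemma topple_step_add:
  assumes "topple_step G \<sigma> \<tau>"
  shows "topple_step G (\<lambda>v. \<sigma> v + \<kappa> v) (\<lambda>v. \<tau> v + \<kappa> v)"
  using assms
proof cases
  case (1 v)
  have "(\<lambda>w. \<tau> w + \<kappa> w) = topple G v (\<lambda>w. \<sigma> w + \<kappa> w)"
    using 1 by (auto simp: topple_def fun_eq_iff)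
  then show ?thesis using 1 by (auto intro: topple_step.intros)
qed

lemma topple_steps_add:
  assumes "(topple_step G)\<^sup>*\<^sup>* \<sigma> \<tau>"
  shows "(topple_step G)\<^sup>*\<^sup>* (\<lambda>v. \<sigma> v + \<kappa> v) (\<lambda>v. \<tau> v + \<kappa> v)"
  using assms by induction (auto intro: topple_step_add rtranclp.rtrancl_into_rtrancl)

text \<open>Toppling one vertex never removes grains from another, so two different legal topplings
  stay legal after each other and commute.\<close>

lemma topple_step_confluent: "confluentp (topple_step G)"
proof (rule strong_confluentp_imp_confluentp, rule strong_confluentpI)
  fix \<sigma> \<tau>1 \<tau>2 assume "topple_step G \<sigma> \<tau>1" "topple_step G \<sigma> \<tau>2"
  then obtain v w where v: "v \<in> nonsink G" "deg G v \<le> \<sigma> v" "\<tau>1 = topple G v \<sigma>"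
    and w: "w \<in> nonsink G" "deg G w \<le> \<sigma> w" "\<tau>2 = topple G w \<sigma>"
    by (auto elim!: topple_step.cases)
  show "\<exists>\<rho>. (topple_step G)\<^sup>*\<^sup>* \<tau>1 \<rho> \<and> (topple_step G)\<^sup>=\<^sup>= \<tau>2 \<rho>"
  proof (cases "v = w")
    case True
    then show ?thesis using v w by auto
  next
    case False
    have "topple_step G \<tau>1 (topple G w \<tau>1)"
      using v w False by (intro topple_step.intros) (auto simp: topple_def)
    moreover have "topple_step G \<tau>2 (topple G v \<tau>2)"
      using v w False by (intro topple_step.intros) (auto simp: topple_def)
    moreover have "topple G w \<tau>1 = topple G v \<tau>2"
      using v w False by (auto simp: topple_def fun_eq_iff)
    ultimately show ?thesis by (intro exI[of _ "topple G w \<tau>1"]) auto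
  qed
qed

lemma stable_topple_steps:
  assumes "stable G \<sigma>" "(topple_step G)\<^sup>*\<^sup>* \<sigma> \<tau>"
  shows "\<tau> = \<sigma>"
  using assms(2,1)
  by (induction rule: converse_rtranclp_induct) (fastforce simp: stable_def elim: topple_step.cases)+

lemma stabilizes_to_unique:
  assumes "stabilizes_to G \<sigma> \<tau>" "stabilizes_to G \<sigma> \<tau>'"
  shows "\<tau> = \<tau>'"
proof -
  obtain \<rho> where "(topple_step G)\<^sup>*\<^sup>* \<tau> \<rho>" "(topple_step G)\<^sup>*\<^sup>* \<tau>' \<rho>"
    using assms confluentpD[OF topple_step_confluent] unfolding stabilizes_to_def by blast
  then show ?thesis
    using assms stable_topple_steps unfolding stabilizes_to_def by blast
qed

lemma stabilizes_to_exists: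
  assumes "terminating G"
  shows "\<exists>\<tau>. stabilizes_to G \<sigma> \<tau>"
  using assms unfolding terminating_def
proof (induction \<sigma> rule: wfp_induct_rule)
  case (less \<sigma>)
  show ?case
  proof (cases "stable G \<sigma>")
    case True
    then show ?thesis by (auto simp: stabilizes_to_def)
  next
    case False
    then obtain \<rho> where "topple_step G \<sigma> \<rho>"
      by (auto simp: stable_def not_less intro: topple_step.intros)
    moreover from this less obtain \<tau> where "stabilizes_to G \<rho> \<tau>" by blast
    ultimately show ?thesis
      unfolding stabilizes_to_def by (blast intro: converse_rtranclp_into_rtranclp)
  qed
qed

lemma is_config_topple_steps:
  assumes "(topple_step G)\<^sup>*\<^sup>* \<sigma> \<tau>" "is_config G \<sigma>"
  shows "is_config G \<tau>"
  using assms
  by induction (auto simp: is_config_def topple_def elim!: topple_step.cases)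

lemma adds_exists:
  assumes "terminating G" "set vs \<subseteq> nonsink G"
  shows "\<exists>\<tau>. adds G \<sigma> vs \<tau>"
  using assms(2)
proof (induction vs arbitrary: \<sigma>)
  case (Cons v vs)
  obtain \<rho> where \<rho>: "stabilizes_to G (\<sigma>(v := \<sigma> v + 1)) \<rho>"
    using stabilizes_to_exists[OF assms(1)] by blast
  moreover obtain \<tau> where "adds G \<rho> vs \<tau>" using Cons by auto
  ultimately show ?case using Cons.prems by (auto intro!: exI[of _ \<tau>] adds.adds_Cons)
qed (blast intro: adds.adds_Nil)

lemma adds_invariants:
  assumes "adds G \<sigma> vs \<tau>" "is_config G \<sigma>" "stable G \<sigma>"
  shows "is_config G \<tau> \<and> stable G \<tau>"
  using assms
proof (induction rule: adds.induct)
  case (adds_Cons v \<sigma> \<rho> vs \<tau>)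
  then have "is_config G (\<sigma>(v := \<sigma> v + 1))" by (auto simp: is_config_def)
  then show ?case
    using adds_Cons is_config_topple_steps by (auto simp: stabilizes_to_def)
qed simp

lemma adds_set_subset: "adds G \<sigma> vs \<tau> \<Longrightarrow> set vs \<subseteq> nonsink G"
  by (induction rule: adds.induct) auto

text \<open>Extra grains never make a toppling illegal, so all grains may be placed before the first
  toppling. A whole drop sequence thus becomes one toppling run that depends only on how often each
  vertex is chosen.\<close>

lemma adds_topple_steps:
  "adds G \<sigma> vs \<tau> \<Longrightarrow> (topple_step G)\<^sup>*\<^sup>* (\<lambda>v. \<sigma> v + count_list vs v) \<tau>"
proof (induction rule: adds.induct)
  case (adds_Cons v \<sigma> \<rho> vs \<tau>)
  have "(\<lambda>w. (\<sigma>(v := \<sigma> v + 1)) w + count_list vs w) = (\<lambda>w. \<sigma> w + count_list (v # vs) w)"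
    by (auto simp: fun_eq_iff)
  moreover have "(topple_step G)\<^sup>*\<^sup>* (\<lambda>w. (\<sigma>(v := \<sigma> v + 1)) w + count_list vs w)
      (\<lambda>w. \<rho> w + count_list vs w)"
    by (rule topple_steps_add) (use adds_Cons.hyps(2) in \<open>simp only: stabilizes_to_def\<close>)
  ultimately show ?case using adds_Cons.IH by simp
qed simp

lemma adds_append:
  "adds G \<sigma> (us @ vs) \<tau> \<longleftrightarrow> (\<exists>\<rho>. adds G \<sigma> us \<rho> \<and> adds G \<rho> vs \<tau>)"
proof (induction us arbitrary: \<sigma>)
  case Nil
  show ?case by (auto intro: adds_Nil elim: adds.cases)
next
  case (Cons u us)
  have *: "adds G \<sigma> (u # ws) \<tau> \<longleftrightarrow>
      (\<exists>\<rho>. u \<in> nonsink G \<and> stabilizes_to G (\<sigma>(u := \<sigma> u + 1)) \<rho> \<and> adds G \<rho> ws \<tau>)" for ws \<tau>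
    by (subst adds.simps) auto
  show ?case using Cons by (auto simp: *)
qed

section \<open>Length of sequences that end in a transient configuration\<close>

lemma finite_stable_configs:
  assumes "sink_graph_wf G"
  shows "finite {\<sigma>. is_config G \<sigma> \<and> stable G \<sigma>}"
proof -
  have fin: "finite (nonsink G)" using assms by (simp add: nonsink_def sink_graph_wf_def)
  have "finite {\<sigma>. \<forall>v. (v \<in> nonsink G \<longrightarrow> \<sigma> v \<in> {..Max (deg G ` nonsink G)})
      \<and> (v \<notin> nonsink G \<longrightarrow> \<sigma> v = 0)}"
    by (rule finite_set_of_finite_funs) (use fin in auto)
  then show ?thesis
    by (rule rev_finite_subset)
      (auto simp: is_config_def stable_def intro: order_trans[OF less_imp_le Max_ge] fin)
qed

text \<open>The Abelian property is what makes a configuration recurrent once any earlier one has been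
  revisited: the grains of the cycle can be dropped after all the others.\<close>

lemma recurrent_if_revisited:
  assumes ter: "terminating G"
    and us: "us \<noteq> []"
    and ws: "is_config G \<sigma>" "stable G \<sigma>" "adds G \<sigma> ws \<rho>" "adds G \<sigma> (ws @ us) \<rho>"
    and xs: "adds G \<rho> xs \<tau>"
  shows "recurrent G \<tau>"
proof -
  have \<rho>: "is_config G \<rho> \<and> stable G \<rho>" using adds_invariants ws by blast
  then have \<tau>: "is_config G \<tau> \<and> stable G \<tau>" using adds_invariants xs by blast
  have "set us \<subseteq> nonsink G" using adds_set_subset[OF ws(4)] by simp
  then obtain \<tau>' where \<tau>': "adds G \<tau> us \<tau>'" using adds_exists[OF ter] by blast
  have st': "stable G \<tau>'" using adds_invariants[OF \<tau>'] \<tau> by blast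
  have "adds G \<sigma> (ws @ xs @ us) \<tau>'" "adds G \<sigma> (ws @ us @ xs) \<tau>"
    using ws xs \<tau>' by (auto simp: adds_append)
  \<comment> \<open>Both lists drop equally many grains at each vertex, so both runs stabilize the
    same configuration.\<close>
  from this[THEN adds_topple_steps] have "\<tau>' = \<tau>"
    using \<tau> st' stabilizes_to_unique[of G "\<lambda>v. \<sigma> v + count_list (ws @ xs @ us) v" \<tau>' \<tau>]
    by (simp add: stabilizes_to_def add_ac)
  then show ?thesis using \<tau> \<tau>' us by (auto simp: recurrent_def)
qed

text \<open>Pigeonhole: a longer sequence passes through some stable configuration twice, and
  everything after that is recurrent.\<close>

lemma transient_length_less:
  assumes wf: "sink_graph_wf G" and ter: "terminating G"
    and \<sigma>: "is_config G \<sigma>" "stable G \<sigma>"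
    and vs: "adds G \<sigma> vs \<tau>" and tr: "transient G \<tau>"
  shows "length vs < card {\<sigma>. is_config G \<sigma> \<and> stable G \<sigma>}"
proof (rule ccontr)
  let ?S = "{\<sigma>. is_config G \<sigma> \<and> stable G \<sigma>}"
  assume "\<not> length vs < card ?S"
  then have card: "card ?S < card {..length vs}" by simp
  have "\<exists>\<rho>. adds G \<sigma> (take i vs) \<rho> \<and> adds G \<rho> (drop i vs) \<tau>" for i
    using vs adds_append[of G \<sigma> "take i vs" "drop i vs" \<tau>] by simp
  then obtain \<rho> where \<rho>: "\<And>i. adds G \<sigma> (take i vs) (\<rho> i)" "\<And>i. adds G (\<rho> i) (drop i vs) \<tau>"
    by metis
  have "\<rho> ` {..length vs} \<subseteq> ?S" using adds_invariants[OF \<rho>(1)] \<sigma> by blast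
  then have "card (\<rho> ` {..length vs}) \<le> card ?S"
    by (rule card_mono[OF finite_stable_configs[OF wf]])
  then have "card (\<rho> ` {..length vs}) < card {..length vs}"
    using card by (rule le_less_trans)
  then have "\<not> inj_on \<rho> {..length vs}" using pigeonhole by blast
  then obtain i j where ij: "i \<le> length vs" "j \<le> length vs" "i < j" "\<rho> i = \<rho> j"
    unfolding inj_on_def by (metis atMost_iff linorder_neqE_nat)
  define us where "us = take (j - i) (drop i vs)"
  have us: "take j vs = take i vs @ us" "us \<noteq> []"
    using ij take_add[of i "j - i" vs] by (auto simp: us_def)
  have "recurrent G \<tau>"
    by (rule recurrent_if_revisited[OF ter us(2) \<sigma> \<rho>(1)[of i] _ \<rho>(2)[of i]])
      (use \<rho>(1)[of j] us ij in simp)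
  then show False using tr by (simp add: transient_def)
qed

text \<open>\<open>Sup\<close> on the naturals is known to be an upper bound only for bounded sets;
  the preceding length bound supplies this.\<close>

lemma le_tclI:
  assumes wf: "sink_graph_wf G" and ter: "terminating G"
    and vs: "adds G (\<lambda>_. 0) vs \<tau>" "transient G \<tau>"
    and zero: "stable G (\<lambda>_. 0)"
  shows "length vs \<le> tcl G"
  unfolding tcl_def
proof (rule cSup_upper)
  show "bdd_above {length vs |vs. \<exists>\<tau>. adds G (\<lambda>_. 0) vs \<tau> \<and> transient G \<tau>}"
    using transient_length_less[OF wf ter _ zero]
    by (intro bdd_aboveI[of _ "card {\<sigma>. is_config G \<sigma> \<and> stable G \<sigma>}"])
      (fastforce simp: is_config_def)
qed (use vs in auto)

section \<open>Potentials and odometers\<close>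

definition potential :: "'v sink_graph \<Rightarrow> ('v \<Rightarrow> real) \<Rightarrow> ('v \<Rightarrow> nat) \<Rightarrow> real" where
  "potential G \<phi> \<sigma> = (\<Sum>v\<in>nonsink G. real (\<sigma> v) * \<phi> v)"

text \<open>The sum omits the sink, which amounts to the boundary value 0 there. With this sign,
  superharmonic means nonnegative \<open>laplacian\<close>.\<close>

definition laplacian :: "'v sink_graph \<Rightarrow> ('v \<Rightarrow> real) \<Rightarrow> 'v \<Rightarrow> real" where
  "laplacian G \<phi> v = real (deg G v) * \<phi> v - (\<Sum>w\<in>nonsink G. real (mult G v w) * \<phi> w)"

lemma potential_nonneg: "(\<And>v. v \<in> nonsink G \<Longrightarrow> 0 \<le> \<phi> v) \<Longrightarrow> 0 \<le> potential G \<phi> \<sigma>"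
  by (auto simp: potential_def intro!: sum_nonneg)

lemma potential_topple:
  assumes wf: "sink_graph_wf G" and v: "v \<in> nonsink G" "deg G v \<le> \<sigma> v"
  shows "potential G \<phi> (topple G v \<sigma>) = potential G \<phi> \<sigma> - laplacian G \<phi> v"
proof -
  have fin: "finite (nonsink G)" using wf by (simp add: nonsink_def sink_graph_wf_def)
  have loop: "mult G v v = 0" using wf by (simp add: sink_graph_wf_def)
  have "real (topple G v \<sigma> w) * \<phi> w = real (\<sigma> w) * \<phi> w + real (mult G v w) * \<phi> w
      - (if w = v then real (deg G v) * \<phi> v else 0)" if "w \<in> nonsink G" for w
    using that v loop by (auto simp: topple_def of_nat_diff algebra_simps)
  then have "potential G \<phi> (topple G v \<sigma>) = (\<Sum>w\<in>nonsink G. real (\<sigma> w) * \<phi> w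
      + real (mult G v w) * \<phi> w - (if w = v then real (deg G v) * \<phi> v else 0))"
    unfolding potential_def by (intro sum.cong) auto
  also have "\<dots> = potential G \<phi> \<sigma> - laplacian G \<phi> v"
    using fin v by (simp add: potential_def laplacian_def sum.distrib sum_subtractf)
  finally show ?thesis .
qed

text \<open>Each toppling costs at least 1 of a nonnegative potential, so its floor is a decreasing
  natural measure.\<close>

lemma terminating_if_laplacian_ge_1:
  assumes wf: "sink_graph_wf G"
    and nonneg: "\<And>v. v \<in> nonsink G \<Longrightarrow> 0 \<le> \<phi> v"
    and lap: "\<And>v. v \<in> nonsink G \<Longrightarrow> 1 \<le> laplacian G \<phi> v"
  shows "terminating G"
  unfolding terminating_def
proof (rule wfp_if_convertible_to_nat[where f = "\<lambda>\<sigma>. nat \<lfloor>potential G \<phi> \<sigma>\<rfloor>"])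
  fix \<tau> \<sigma> assume "topple_step G \<sigma> \<tau>"
  then have "potential G \<phi> \<tau> + 1 \<le> potential G \<phi> \<sigma>"
    using potential_topple[OF wf] lap by cases fastforce
  moreover have "0 \<le> potential G \<phi> \<tau>" by (rule potential_nonneg[OF nonneg])
  ultimately show "nat \<lfloor>potential G \<phi> \<tau>\<rfloor> < nat \<lfloor>potential G \<phi> \<sigma>\<rfloor>" by linarith
qed

text \<open>Grains can reach \<open>a\<close> only from toppling neighbours, and the initial
  potential cannot pay for even one such toppling.\<close>

lemma zero_if_neighbours_blocked:
  assumes wf: "sink_graph_wf G"
    and nonneg: "\<And>v. v \<in> nonsink G \<Longrightarrow> 0 \<le> \<phi> v"
    and lap: "\<And>v. v \<in> nonsink G \<Longrightarrow> 0 \<le> laplacian G \<phi> v"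
    and blocked: "\<And>v. v \<in> nonsink G \<Longrightarrow> mult G v a \<noteq> 0 \<Longrightarrow> potential G \<phi> \<sigma> < laplacian G \<phi> v"
    and steps: "(topple_step G)\<^sup>*\<^sup>* \<sigma> \<tau>"
    and a: "\<sigma> a = 0"
  shows "\<tau> a = 0"
proof -
  have "potential G \<phi> \<tau> \<le> potential G \<phi> \<sigma> \<and> \<tau> a = 0"
    using steps
  proof induction
    case (step \<rho> \<tau>)
    from step(2) obtain v where v: "v \<in> nonsink G" "deg G v \<le> \<rho> v" "\<tau> = topple G v \<rho>"
      by cases
    have pot: "potential G \<phi> \<tau> = potential G \<phi> \<rho> - laplacian G \<phi> v"
      using potential_topple[OF wf] v by blast
    moreover have "0 \<le> potential G \<phi> \<tau>" by (rule potential_nonneg[OF nonneg])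
    ultimately have "laplacian G \<phi> v \<le> potential G \<phi> \<sigma>" using step by linarith
    then have "mult G v a = 0" using blocked[OF v(1)] by fastforce
    then show ?case using step lap[OF v(1)] v pot by (auto simp: topple_def)
  qed (use a in simp)
  then show ?thesis by simp
qed

text \<open>The function \<open>w\<close> is the odometer, counting the topplings of each vertex. Whichever of
  \<open>a\<close> and \<open>b\<close> topples first leaves a grain on the other, and then this pair never becomes empty.\<close>

lemma odometer_exists:
  assumes wf: "sink_graph_wf G" and steps: "(topple_step G)\<^sup>*\<^sup>* \<sigma> \<tau>"
    and ab: "a \<in> nonsink G" "b \<in> nonsink G" "mult G a b \<noteq> 0"
  shows "\<exists>w. (\<forall>u\<in>nonsink G. \<tau> u + deg G u * w u = \<sigma> u + (\<Sum>x\<in>nonsink G. w x * mult G x u))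
    \<and> (w a \<noteq> 0 \<or> w b \<noteq> 0 \<longrightarrow> \<tau> a + \<tau> b \<noteq> 0)"
  using steps
proof induction
  case base
  show ?case by (rule exI[of _ "\<lambda>_. 0"]) simp
next
  case (step \<rho> \<tau>)
  have fin: "finite (nonsink G)" using wf by (simp add: nonsink_def sink_graph_wf_def)
  have sym: "mult G x y = mult G y x" and loop: "mult G x x = 0" for x y
    using wf by (auto simp: sink_graph_wf_def)
  from step.IH obtain w
    where w: "\<And>u. u \<in> nonsink G \<Longrightarrow>
        \<rho> u + deg G u * w u = \<sigma> u + (\<Sum>x\<in>nonsink G. w x * mult G x u)"
      and wab: "w a \<noteq> 0 \<or> w b \<noteq> 0 \<Longrightarrow> \<rho> a + \<rho> b \<noteq> 0" by blast
  from step(2) obtain v where v: "v \<in> nonsink G" "deg G v \<le> \<rho> v" "\<tau> = topple G v \<rho>"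
    by cases
  define w' where "w' = w(v := w v + 1)"
  have "\<tau> u + deg G u * w' u = \<sigma> u + (\<Sum>x\<in>nonsink G. w' x * mult G x u)"
    if u: "u \<in> nonsink G" for u
  proof -
    have "(\<Sum>x\<in>nonsink G. w' x * mult G x u)
        = (\<Sum>x\<in>nonsink G. w x * mult G x u + (if x = v then mult G v u else 0))"
      by (intro sum.cong) (auto simp: w'_def)
    also have "\<dots> = (\<Sum>x\<in>nonsink G. w x * mult G x u) + mult G v u"
      using fin v by (simp add: sum.distrib)
    finally show ?thesis
      using w[OF u] v u loop by (auto simp: topple_def w'_def)
  qed
  moreover have "\<tau> a + \<tau> b \<noteq> 0" if "w' a \<noteq> 0 \<or> w' b \<noteq> 0"
  proof -
    have "a \<noteq> b" "mult G b a \<noteq> 0" using ab loop sym[of a b] by auto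
    then show ?thesis
      using that wab v ab by (cases "v = a"; cases "v = b") (auto simp: w'_def topple_def)
  qed
  ultimately show ?case by blast
qed

text \<open>By the odometer, a cycle that ends with both vertices empty never topples
  \<open>a\<close>. Grain balance at an untoppled vertex forces that no grain is dropped there and
  no neighbour topples; by \<open>connected\<close>, which is connectivity as an induction
  principle, this spreads to all vertices, so the cycle drops nothing.\<close>

lemma not_recurrent_if_adjacent_zeros:
  assumes wf: "sink_graph_wf G"
    and connected: "\<And>Z. a \<in> Z \<Longrightarrow>
      (\<And>u x. u \<in> Z \<Longrightarrow> u \<in> nonsink G \<Longrightarrow> x \<in> nonsink G \<Longrightarrow> mult G x u \<noteq> 0 \<Longrightarrow> x \<in> Z) \<Longrightarrow> nonsink G \<subseteq> Z"
    and ab: "a \<in> nonsink G" "b \<in> nonsink G" "mult G a b \<noteq> 0"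
    and zero: "\<sigma> a = 0" "\<sigma> b = 0"
  shows "\<not> recurrent G \<sigma>"
proof
  assume "recurrent G \<sigma>"
  then obtain vs where vs: "vs \<noteq> []" "adds G \<sigma> vs \<sigma>" by (auto simp: recurrent_def)
  have fin: "finite (nonsink G)" using wf by (simp add: nonsink_def sink_graph_wf_def)
  obtain w where w: "\<And>u. u \<in> nonsink G \<Longrightarrow>
        \<sigma> u + deg G u * w u = \<sigma> u + count_list vs u + (\<Sum>x\<in>nonsink G. w x * mult G x u)"
    and "w a \<noteq> 0 \<or> w b \<noteq> 0 \<longrightarrow> \<sigma> a + \<sigma> b \<noteq> 0"
    using odometer_exists[OF wf adds_topple_steps[OF vs(2)] ab] by blast
  then have "w a = 0" using zero by simp
  have closed: "count_list vs u = 0 \<and> (\<forall>x\<in>nonsink G. mult G x u \<noteq> 0 \<longrightarrow> w x = 0)"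
    if "u \<in> nonsink G" "w u = 0" for u
  proof -
    have "count_list vs u + (\<Sum>x\<in>nonsink G. w x * mult G x u) = 0"
      using w[OF that(1)] that(2) by simp
    then show ?thesis using fin by auto
  qed
  have "nonsink G \<subseteq> {u. w u = 0}"
    by (rule connected) (use closed \<open>w a = 0\<close> in blast)+
  moreover have "hd vs \<in> nonsink G"
    using adds_set_subset[OF vs(2)] hd_in_set[OF vs(1)] by blast
  ultimately have "count_list vs (hd vs) = 0" using closed by blast
  then show False using vs(1) by (simp add: count_list_0_iff)
qed

section \<open>A superharmonic function on the grid\<close>

text \<open>
  The function \<open>x * y / (x\<^sup>2 + y\<^sup>2)\<^sup>2\<close> is harmonic on the open quadrant and vanishes on its sides.
  Adding \<open>c\<close> to \<open>x\<^sup>2 + y\<^sup>2\<close> changes its Laplacian to \<open>- 24 * c * x * y / (x\<^sup>2 + y\<^sup>2 + c) ^ 4\<close>; for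
  \<open>c = 24\<close> this dominates the discretization error, which has the same order.
\<close>

definition corner_potential :: "real \<Rightarrow> real \<Rightarrow> real" where
  "corner_potential x y = x * y / (x\<^sup>2 + y\<^sup>2 + 24)\<^sup>2"

text \<open>Used with Q = x^2 + y^2 + 25, for which Q + 2x and Q - 2x are the denominators (x + 1)^2
  + y^2 + 24 and (x - 1)^2 + y^2 + 24 of two opposite neighbours, before squaring.\<close>

lemma shifted_pair_sum:
  fixes x y Q :: real
  assumes "Q > 2 * x" "Q > - 2 * x"
  shows "(x + 1) * y / (Q + 2 * x)\<^sup>2 + (x - 1) * y / (Q - 2 * x)\<^sup>2
       = 2 * (x * y) * ((Q\<^sup>2 - 4 * Q + 4 * x\<^sup>2) / (Q\<^sup>2 - 4 * x\<^sup>2)\<^sup>2)"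
proof -
  have nz: "Q + 2 * x \<noteq> 0" "Q - 2 * x \<noteq> 0" using assms by auto
  have e: "Q\<^sup>2 - 4 * x\<^sup>2 = (Q + 2 * x) * (Q - 2 * x)" by (simp add: algebra_simps power2_eq_square)
  show ?thesis unfolding e using nz
    by (simp add: divide_simps power_mult_distrib) algebra
qed

text \<open>At q = 0 the left side is 1 + 3t + 5t^2 + 7t^3 + ...; raising the coefficient 5 to 7
  absorbs the tail. The threshold 2/11 is where the factor 2 - 11t below changes sign.\<close>

lemma shifted_pair_bound:
  fixes q t :: real
  assumes "0 \<le> q" "0 \<le> t" "t \<le> 2 / 11"
  shows "(1 - 4 * q + t) / (1 - t)\<^sup>2 \<le> 1 - 4 * q + 3 * t + 7 * t\<^sup>2"
proof -
  have "(1 - 4 * q + 3 * t + 7 * t\<^sup>2) * (1 - t)\<^sup>2 - (1 - 4 * q + t)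
      = 4 * (q * t) * (2 - t) + t\<^sup>2 * (2 - 11 * t) + 7 * (t\<^sup>2)\<^sup>2"
    by (simp add: algebra_simps power2_eq_square)
  also have "\<dots> \<ge> 0" using assms by (intro add_nonneg_nonneg mult_nonneg_nonneg) auto
  finally show ?thesis using assms by (simp add: pos_divide_le_eq)
qed

lemma corner_potential_laplacian:
  fixes x y :: real
  assumes "0 \<le> x" "0 \<le> y"
  shows "corner_potential (x + 1) y + corner_potential (x - 1) y
       + corner_potential x (y + 1) + corner_potential x (y - 1)
       \<le> 4 * corner_potential x y - 376 * (x * y) / (x\<^sup>2 + y\<^sup>2 + 25) ^ 4"
proof -
  \<comment> \<open>The four neighbours contribute \<open>2 * (x * y) * (h (4 * x\<^sup>2) + h (4 * y\<^sup>2))\<close>, and \<open>h\<close> is expanded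
    to second order in \<open>q = 1 / Q\<close>.\<close>
  define Q where "Q = x\<^sup>2 + y\<^sup>2 + 25"
  define q where "q = 1 / Q"
  define h where "h a = (Q\<^sup>2 - 4 * Q + a) / (Q\<^sup>2 - a)\<^sup>2" for a
  have Q: "Q \<ge> 25" by (simp add: Q_def)
  then have q: "0 < q" "q \<le> 1 / 25" by (auto simp: q_def divide_simps)
  have Qq: "Q * q = 1" using Q by (simp add: q_def)
  have pos: "Q > 2 * x" "Q > 2 * y"
    using sum_power2_ge_zero[of "x - 1" y] sum_power2_ge_zero[of x "y - 1"]
    by (auto simp: Q_def power2_eq_square algebra_simps)
  have X: "corner_potential (x + 1) y + corner_potential (x - 1) y = 2 * (x * y) * h (4 * x\<^sup>2)"
    using shifted_pair_sum[of x Q y] pos assms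
    by (simp add: corner_potential_def h_def Q_def power2_eq_square algebra_simps)
  have Y: "corner_potential x (y + 1) + corner_potential x (y - 1) = 2 * (x * y) * h (4 * y\<^sup>2)"
    using shifted_pair_sum[of y Q x] pos assms
    by (simp add: corner_potential_def h_def Q_def power2_eq_square algebra_simps)
  define t where "t a = a * q\<^sup>2" for a
  have hb: "h a \<le> q\<^sup>2 * (1 - 4 * q + 3 * t a + 7 * (t a)\<^sup>2)" if a: "0 \<le> a" "a \<le> 4 * Q" for a
  proof -
    \<comment> \<open>Q >= 25 yields 4q <= 4/25, which is below 2/11.\<close>
    have "t a \<le> 4 * Q * q\<^sup>2" unfolding t_def using a by (intro mult_right_mono) auto
    also have "\<dots> = 4 * q" using Qq by (simp add: power2_eq_square mult.assoc)
    finally have t: "0 \<le> t a" "t a \<le> 2 / 11" using q a by (auto simp: t_def)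
    have "h a = q\<^sup>2 * ((1 - 4 * q + t a) / (1 - t a)\<^sup>2)"
    proof -
      have 1: "Q\<^sup>2 - 4 * Q + a = Q\<^sup>2 * (1 - 4 * q + t a)"
        using Qq unfolding t_def by algebra
      have 2: "Q\<^sup>2 - a = Q\<^sup>2 * (1 - t a)" using Qq unfolding t_def by algebra
      have "Q\<^sup>2 / (Q\<^sup>2)\<^sup>2 = q\<^sup>2" using Q by (simp add: q_def power2_eq_square)
      then have "Q\<^sup>2 * A / (Q\<^sup>2 * B)\<^sup>2 = q\<^sup>2 * (A / B\<^sup>2)" for A B
        by (metis power_mult_distrib times_divide_times_eq)
      then show ?thesis unfolding h_def 1 2 .
    qed
    then show ?thesis
      using mult_left_mono[OF shifted_pair_bound[of q "t a"], of "q\<^sup>2"] q t by simp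
  qed
  have "h (4 * x\<^sup>2) + h (4 * y\<^sup>2)
      \<le> q\<^sup>2 * (2 - 8 * q + 3 * (t (4 * x\<^sup>2) + t (4 * y\<^sup>2)) + 7 * ((t (4 * x\<^sup>2))\<^sup>2 + (t (4 * y\<^sup>2))\<^sup>2))"
    using add_mono[OF hb[of "4 * x\<^sup>2"] hb[of "4 * y\<^sup>2"]]
    by (simp add: Q_def algebra_simps)
  \<comment> \<open>The coefficient of q^2 is 7 * 16 from the squares minus 3 * 100 from the shift
    25 in Q, hence -188.\<close>
  also have "\<dots> \<le> q\<^sup>2 * (2 + 4 * q - 188 * q\<^sup>2)"
  proof (rule mult_left_mono)
    have s: "t (4 * x\<^sup>2) + t (4 * y\<^sup>2) = 4 * q - 100 * q\<^sup>2"
      using Qq unfolding t_def Q_def by algebra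
    have nn: "0 \<le> t (4 * x\<^sup>2)" "0 \<le> t (4 * y\<^sup>2)" by (auto simp: t_def)
    have "(t (4 * x\<^sup>2))\<^sup>2 + (t (4 * y\<^sup>2))\<^sup>2 \<le> (t (4 * x\<^sup>2) + t (4 * y\<^sup>2))\<^sup>2"
      using mult_nonneg_nonneg[OF nn] by (simp add: power2_sum)
    also have "\<dots> \<le> (4 * q)\<^sup>2"
    proof (rule power_mono)
      show "t (4 * x\<^sup>2) + t (4 * y\<^sup>2) \<le> 4 * q" unfolding s by simp
    qed (use nn in simp)
    finally show "2 - 8 * q + 3 * (t (4 * x\<^sup>2) + t (4 * y\<^sup>2)) + 7 * ((t (4 * x\<^sup>2))\<^sup>2 + (t (4 * y\<^sup>2))\<^sup>2)
        \<le> 2 + 4 * q - 188 * q\<^sup>2"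
      unfolding s by (simp add: power_mult_distrib)
  qed simp
  finally have H: "h (4 * x\<^sup>2) + h (4 * y\<^sup>2) \<le> q\<^sup>2 * (2 + 4 * q - 188 * q\<^sup>2)" .
  \<comment> \<open>Here x^2 + y^2 + 24 = Q - 1, and 2 / (1 - q)^2 = 2 + 4q + 6q^2 + ... covers the
    linear term exactly.\<close>
  have P: "q\<^sup>2 * (2 + 4 * q) \<le> 2 / (x\<^sup>2 + y\<^sup>2 + 24)\<^sup>2"
  proof -
    have "q * (x\<^sup>2 + y\<^sup>2 + 24) = 1 - q" using Qq by (simp add: Q_def algebra_simps)
    then have "q\<^sup>2 * (2 + 4 * q) * (x\<^sup>2 + y\<^sup>2 + 24)\<^sup>2 = (1 - q)\<^sup>2 * (2 + 4 * q)" by algebra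
    also have "\<dots> = 2 - q\<^sup>2 * (6 - 4 * q)" by (simp add: algebra_simps power2_eq_square)
    also have "\<dots> \<le> 2" using q by simp
    finally have "q\<^sup>2 * (2 + 4 * q) * (x\<^sup>2 + y\<^sup>2 + 24)\<^sup>2 \<le> 2" .
    moreover have "0 < (x\<^sup>2 + y\<^sup>2 + 24)\<^sup>2" by (intro zero_less_power add_nonneg_pos) auto
    ultimately show ?thesis by (simp only: pos_le_divide_eq)
  qed
  have "2 * (x * y) * (h (4 * x\<^sup>2) + h (4 * y\<^sup>2))
      \<le> 2 * (x * y) * (2 / (x\<^sup>2 + y\<^sup>2 + 24)\<^sup>2 - 188 * q\<^sup>2 * q\<^sup>2)"
    using H P assms by (intro mult_left_mono) (auto simp: algebra_simps)
  also have "\<dots> = 4 * corner_potential x y - 376 * (x * y) / Q ^ 4"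
    by (simp add: corner_potential_def q_def field_simps power2_eq_square power4_eq_xxxx)
  finally show ?thesis
    using X Y by (simp add: Q_def algebra_simps)
qed

text \<open>
  The second function in the minimum is harmonic also in the discrete sense and vanishes on the far
  sides. Its factor \<open>32\<close> makes it exceed \<open>corner_potential\<close> along the border of the square
  \<open>2 * x < m \<and> 2 * y < m\<close>, so that omitting it inside keeps the result superharmonic.
\<close>

definition grid_potential :: "real \<Rightarrow> real \<Rightarrow> real \<Rightarrow> real" where
  "grid_potential m x y =
    (if 2 * x < m \<and> 2 * y < m then corner_potential x y
     else min (corner_potential x y) (32 * ((m - x) * (m - y)) / m ^ 4))"

section \<open>Superharmonicity of \<open>grid_potential\<close>\<close>

lemma corner_potential_nonneg: "0 \<le> x \<Longrightarrow> 0 \<le> y \<Longrightarrow> 0 \<le> corner_potential x y"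
  by (simp add: corner_potential_def)

lemma corner_potential_le:
  assumes "0 < s" "s \<le> x\<^sup>2 + y\<^sup>2"
  shows "corner_potential x y \<le> 1 / (2 * s)"
proof -
  define P where "P = x\<^sup>2 + y\<^sup>2 + 24"
  have P: "0 < P" "s \<le> P" using assms by (auto simp: P_def)
  have "2 * (x * y) \<le> P" using sum_squares_bound[of x y] by (simp add: P_def)
  then have "corner_potential x y \<le> (P / 2) / P\<^sup>2"
    unfolding corner_potential_def P_def[symmetric] by (intro divide_right_mono) auto
  also have "\<dots> = 1 / (2 * P)" using P by (simp add: power2_eq_square)
  also have "\<dots> \<le> 1 / (2 * s)" using P assms by (simp add: frac_le)
  finally show ?thesis .
qed

lemma grid_potential_nonneg:
  "0 \<le> x \<Longrightarrow> 0 \<le> y \<Longrightarrow> x \<le> m \<Longrightarrow> y \<le> m \<Longrightarrow> 0 \<le> grid_potential m x y"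
  by (auto simp: grid_potential_def corner_potential_nonneg)

lemma grid_potential_le_corner: "grid_potential m x y \<le> corner_potential x y"
  by (simp add: grid_potential_def)

text \<open>The 2 in \<open>far\<close> allows one step into the square. There
  \<open>corner_potential\<close> is at most 8 / m^2, and the factor 32 makes the second function at
  least 8 / m^2.\<close>

lemma grid_potential_le_far:
  assumes m: "m \<ge> 4" and xy: "0 \<le> x" "0 \<le> y" and far: "m \<le> 2 * x + 2 \<or> m \<le> 2 * y + 2"
  shows "grid_potential m x y \<le> 32 * ((m - x) * (m - y)) / m ^ 4"
proof (cases "2 * x < m \<and> 2 * y < m")
  case True
  have sq: "m\<^sup>2 / 16 \<le> z\<^sup>2" if "m \<le> 2 * z + 2" for z
  proof -
    have "m / 4 \<le> z" using m that by simp
    then have "(m / 4)\<^sup>2 \<le> z\<^sup>2" using m by (intro power_mono) auto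
    then show ?thesis by (simp add: power_divide)
  qed
  have "m\<^sup>2 / 16 \<le> x\<^sup>2 + y\<^sup>2"
    using far sq[of x] sq[of y] zero_le_power2[of x] zero_le_power2[of y] by linarith
  then have "corner_potential x y \<le> 1 / (2 * (m\<^sup>2 / 16))"
    using m by (intro corner_potential_le) auto
  also have "\<dots> = 32 * ((m / 2) * (m / 2)) / m ^ 4"
    using m by (simp add: power2_eq_square power4_eq_xxxx)
  also have "\<dots> \<le> 32 * ((m - x) * (m - y)) / m ^ 4"
    using True m by (intro divide_right_mono mult_left_mono mult_mono) auto
  finally show ?thesis using True by (simp add: grid_potential_def)
qed (auto simp: grid_potential_def)

text \<open>Whichever of the two functions gives the value at the point also bounds
  \<open>grid_potential\<close> at the four neighbours, so its own superharmonicity carries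
  over.\<close>

lemma grid_potential_superharmonic:
  assumes m: "m \<ge> 4" and x: "1 \<le> x" "x \<le> m - 1" and y: "1 \<le> y" "y \<le> m - 1"
  shows "grid_potential m (x + 1) y + grid_potential m (x - 1) y
       + grid_potential m x (y + 1) + grid_potential m x (y - 1) \<le> 4 * grid_potential m x y"
proof (cases "grid_potential m x y = corner_potential x y")
  case True
  have "0 \<le> 376 * (x * y) / (x\<^sup>2 + y\<^sup>2 + 25) ^ 4" using x y by simp
  then show ?thesis
    using corner_potential_laplacian[of x y] x y True
      grid_potential_le_corner[of m "x + 1" y] grid_potential_le_corner[of m "x - 1" y]
      grid_potential_le_corner[of m x "y + 1"] grid_potential_le_corner[of m x "y - 1"]
    by linarith
next
  case False
  then have far: "m \<le> 2 * x \<or> m \<le> 2 * y"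
    and eq: "grid_potential m x y = 32 * ((m - x) * (m - y)) / m ^ 4"
    by (auto simp: grid_potential_def min_def split: if_splits)
  have "grid_potential m (x + 1) y + grid_potential m (x - 1) y
       + grid_potential m x (y + 1) + grid_potential m x (y - 1)
     \<le> 32 * ((m - (x + 1)) * (m - y)) / m ^ 4 + 32 * ((m - (x - 1)) * (m - y)) / m ^ 4
       + 32 * ((m - x) * (m - (y + 1))) / m ^ 4 + 32 * ((m - x) * (m - (y - 1))) / m ^ 4"
    using far m x y by (intro add_mono grid_potential_le_far) auto
  also have "\<dots> = 4 * (32 * ((m - x) * (m - y)) / m ^ 4)"
    by (simp add: add_divide_distrib[symmetric]) (simp add: algebra_simps)
  finally show ?thesis using eq by simp
qed

lemma grid_potential_laplacian_corner:
  assumes m: "m > 6" and x: "1 \<le> x" "x \<le> 3" and y: "1 \<le> y" "y \<le> 3"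
  shows "grid_potential m (x + 1) y + grid_potential m (x - 1) y
       + grid_potential m x (y + 1) + grid_potential m x (y - 1)
       \<le> 4 * grid_potential m x y - 1 / 10000"
proof -
  have "x\<^sup>2 \<le> 3\<^sup>2" "y\<^sup>2 \<le> 3\<^sup>2"
    using power_mono[of x 3 2] power_mono[of y 3 2] x y by auto
  \<comment> \<open>43 = 9 + 9 + 25, and 376 / 43^4 is slightly above 1 / 10000.\<close>
  then have "(x\<^sup>2 + y\<^sup>2 + 25) ^ 4 \<le> 43 ^ 4" by (intro power_mono) auto
  moreover have "1 \<le> x * y" using mult_mono[of 1 x 1 y] x y by simp
  moreover have "0 < (x\<^sup>2 + y\<^sup>2 + 25) ^ 4" by (intro zero_less_power add_nonneg_pos) auto
  ultimately have "376 * 1 / 43 ^ 4 \<le> 376 * (x * y) / (x\<^sup>2 + y\<^sup>2 + 25) ^ 4"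
    by (intro frac_le) auto
  then have "1 / 10000 \<le> 376 * (x * y) / (x\<^sup>2 + y\<^sup>2 + 25) ^ 4" by simp
  moreover have "grid_potential m x y = corner_potential x y"
    using m x y by (simp add: grid_potential_def)
  ultimately show ?thesis
    using corner_potential_laplacian[of x y] x y 
      grid_potential_le_corner[of m "x + 1" y] grid_potential_le_corner[of m "x - 1" y]
      grid_potential_le_corner[of m x "y + 1"] grid_potential_le_corner[of m x "y - 1"]
    by linarith
qed


section \<open>The grid\<close>

lemma nonsink_grid: "nonsink (grid n) = Some ` cells n"
  by (auto simp: nonsink_def grid_def)

lemma mult_grid: "mult (grid n) (Some p) (Some q) = (if cell_adj n p q then 1 else 0)"
  by (simp add: grid_def)

definition on_cells :: "(real \<Rightarrow> real \<Rightarrow> real) \<Rightarrow> (nat \<times> nat) option \<Rightarrow> real" where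
  "on_cells f = case_option 0 (\<lambda>p. f (real (fst p)) (real (snd p)))"

text \<open>Only an inequality: neighbours with coordinate 0 or n + 1 count as 0 in the graph but as
  a nonnegative value of \<open>f\<close> in the four-point sum.\<close>

lemma laplacian_grid_ge:
  fixes f :: "real \<Rightarrow> real \<Rightarrow> real"
  assumes p: "(i, j) \<in> cells n"
    and nonneg: "\<And>x y. 0 \<le> x \<Longrightarrow> x \<le> real n + 1 \<Longrightarrow> 0 \<le> y \<Longrightarrow> y \<le> real n + 1 \<Longrightarrow> 0 \<le> f x y"
  shows "4 * f i j - (f (real i + 1) j + f (real i - 1) j + f i (real j + 1) + f i (real j - 1))
    \<le> laplacian (grid n) (on_cells f) (Some (i, j))"
proof -
  define g where "g q = f (real (fst q)) (real (snd q))" for q :: "nat \<times> nat"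
  let ?N = "{(i + 1, j), (i - 1, j), (i, j + 1), (i, j - 1)}"
  have ij: "1 \<le> i" "i \<le> n" "1 \<le> j" "j \<le> n" using p by (auto simp: cells_def)
  have eq: "cells n \<inter> {q. cell_adj n (i, j) q} = {q. cell_adj n (i, j) q}"
    by (auto simp: cell_adj_def)
  have "(\<Sum>v\<in>nonsink (grid n). real (mult (grid n) (Some (i, j)) v) * on_cells f v)
      = (\<Sum>q\<in>cells n. if cell_adj n (i, j) q then g q else 0)"
    unfolding nonsink_grid by (subst sum.reindex) (auto simp: mult_grid on_cells_def g_def intro!: sum.cong)
  also have "\<dots> = (\<Sum>q\<in>{q. cell_adj n (i, j) q}. g q)"
    by (simp add: sum.If_cases finite_cells eq)
  also have "\<dots> \<le> (\<Sum>q\<in>?N. g q)"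
  proof (rule sum_mono2)
    show "{q. cell_adj n (i, j) q} \<subseteq> ?N" by (auto simp: cell_adj_def differ_by_1_def)
    show "0 \<le> g q" if "q \<in> ?N - {q. cell_adj n (i, j) q}" for q
      unfolding g_def using that ij by (intro nonneg) auto
  qed simp
  also have "\<dots> = f (real i + 1) j + f (real i - 1) j + f i (real j + 1) + f i (real j - 1)"
    using ij by (simp add: g_def of_nat_diff add_ac)
  finally have "(\<Sum>v\<in>nonsink (grid n). real (mult (grid n) (Some (i, j)) v) * on_cells f v) \<le> \<dots>" .
  moreover have "deg (grid n) (Some (i, j)) = 4"
    using p by (intro deg_grid) (simp add: nonsink_grid)
  ultimately show ?thesis by (simp add: laplacian_def on_cells_def)
qed

lemma on_cells_nonneg:
  assumes "v \<in> nonsink (grid n)"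
    and "\<And>x y. 0 \<le> x \<Longrightarrow> x \<le> real n + 1 \<Longrightarrow> 0 \<le> y \<Longrightarrow> y \<le> real n + 1 \<Longrightarrow> 0 \<le> f x y"
  shows "0 \<le> on_cells f v"
  using assms by (auto simp: nonsink_grid on_cells_def cells_def)

lemma terminating_grid: "terminating (grid n)"
proof (rule terminating_if_laplacian_ge_1[OF grid_wf])
  \<comment> \<open>The second difference of x * (n + 1 - x) is -2, so the four-point Laplacian is 2
    everywhere.\<close>
  let ?f = "\<lambda>x y :: real. x * (real n + 1 - x)"
  fix v assume v: "v \<in> nonsink (grid n)"
  have nonneg: "0 \<le> ?f x y" if "0 \<le> x" "x \<le> real n + 1" for x y
    using that by simp
  show "0 \<le> on_cells ?f v" using v nonneg by (rule on_cells_nonneg)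
  from v obtain i j where ij: "v = Some (i, j)" "(i, j) \<in> cells n" by (auto simp: nonsink_grid)
  show "1 \<le> laplacian (grid n) (on_cells ?f) v"
    using laplacian_grid_ge[OF ij(2), of ?f, OF nonneg] by (simp add: ij(1) algebra_simps)
qed

lemma grid_connected:
  assumes start: "Some (1, 1) \<in> Z"
    and closed: "\<And>u x. u \<in> Z \<Longrightarrow> u \<in> nonsink (grid n) \<Longrightarrow> x \<in> nonsink (grid n) \<Longrightarrow>
      mult (grid n) x u \<noteq> 0 \<Longrightarrow> x \<in> Z"
  shows "nonsink (grid n) \<subseteq> Z"
proof -
  have step: "Some q \<in> Z" if "Some p \<in> Z" "cell_adj n q p" for p q
    using closed[of "Some p" "Some q"] that by (auto simp: mult_grid nonsink_grid cell_adj_def)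
  have row: "Some (i, 1) \<in> Z" if "1 \<le> i" "i \<le> n" for i
    using that
  proof (induction i rule: nat_induct_at_least)
    case (Suc i)
    show ?case
      by (rule step[of "(i, 1)"]) (use Suc in \<open>auto simp: cell_adj_def cells_def differ_by_1_def\<close>)
  qed (use start in simp)
  have "Some (i, j) \<in> Z" if "1 \<le> j" "j \<le> n" "1 \<le> i" "i \<le> n" for i j
    using that
  proof (induction j rule: nat_induct_at_least)
    case (Suc j)
    show ?case
      by (rule step[of "(i, j)"]) (use Suc in \<open>auto simp: cell_adj_def cells_def differ_by_1_def\<close>)
  qed (use row in simp)
  then show ?thesis by (auto simp: nonsink_grid cells_def)
qed

section \<open>The lower bound on \<open>tcl\<close>\<close>

lemma count_list_replicate: "count_list (replicate k x) y = (if y = x then k else 0)"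
  by (induction k) auto

text \<open>Hypothesis \<open>N\<close> compares the potential of N grains at (n, n), where (m - x)
  * (m - y) = 1 for m = n + 1, with the cost 1 / 10000 of a toppling next to (1, 1) or (1,
  2).\<close>

lemma le_tcl_grid:
  assumes n: "6 \<le> n" and N: "real N * (32 / (real n + 1) ^ 4) < 1 / 10000"
  shows "N \<le> tcl (grid n)"
proof -
  let ?G = "grid n" and ?\<phi> = "on_cells (grid_potential (real n + 1))"
  let ?c = "Some (n, n)" and ?a = "Some (1, 1)" and ?b = "Some (1, 2)"
  let ?vs = "replicate N ?c"
  let ?\<sigma> = "\<lambda>v. 0 + count_list ?vs v"
  have c: "?c \<in> nonsink ?G" and ab: "?a \<in> nonsink ?G" "?b \<in> nonsink ?G" "mult ?G ?a ?b \<noteq> 0"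
    using n by (auto simp: nonsink_grid cells_def mult_grid cell_adj_def differ_by_1_def)
  have zero: "stable ?G (\<lambda>_. 0)" by (simp add: stable_def deg_grid)
  have nonneg: "0 \<le> ?\<phi> v" if "v \<in> nonsink ?G" for v
    using that by (rule on_cells_nonneg) (simp add: grid_potential_nonneg)
  have superharmonic: "0 \<le> laplacian ?G ?\<phi> v" if v: "v \<in> nonsink ?G" for v
  proof -
    from v obtain i j where ij: "v = Some (i, j)" "(i, j) \<in> cells n" by (auto simp: nonsink_grid)
    have "laplacian ?G ?\<phi> (Some (i, j)) \<ge> 4 * grid_potential (real n + 1) i j
      - (grid_potential (real n + 1) (real i + 1) j + grid_potential (real n + 1) (real i - 1) j
       + grid_potential (real n + 1) i (real j + 1) + grid_potential (real n + 1) i (real j - 1))"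
      using ij(2) by (rule laplacian_grid_ge) (simp add: grid_potential_nonneg)
    then show ?thesis
      using grid_potential_superharmonic[of "real n + 1" i j] ij n by (simp add: cells_def)
  qed
  have corner: "1 / 10000 \<le> laplacian ?G ?\<phi> v"
    if v: "v \<in> nonsink ?G" "mult ?G v ?a \<noteq> 0 \<or> mult ?G v ?b \<noteq> 0" for v
  proof -
    from v obtain i j where ij: "v = Some (i, j)" "(i, j) \<in> cells n" by (auto simp: nonsink_grid)
    have "1 \<le> i" "i \<le> 3" "1 \<le> j" "j \<le> 3"
      using v(2) ij
      by (auto simp: mult_grid cell_adj_def differ_by_1_def cells_def split: if_splits)
    moreover have "laplacian ?G ?\<phi> (Some (i, j)) \<ge> 4 * grid_potential (real n + 1) i j
      - (grid_potential (real n + 1) (real i + 1) j + grid_potential (real n + 1) (real i - 1) j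
       + grid_potential (real n + 1) i (real j + 1) + grid_potential (real n + 1) i (real j - 1))"
      using ij(2) by (rule laplacian_grid_ge) (simp add: grid_potential_nonneg)
    ultimately show ?thesis
      using grid_potential_laplacian_corner[of "real n + 1" i j] ij n by simp
  qed
  have "?\<phi> ?c \<le> 32 * ((real n + 1 - n) * (real n + 1 - n)) / (real n + 1) ^ 4"
    using n grid_potential_le_far[of "real n + 1" n n] by (simp add: on_cells_def)
  then have "real N * ?\<phi> ?c \<le> real N * (32 / (real n + 1) ^ 4)"
    by (intro mult_left_mono) auto
  moreover have "potential ?G ?\<phi> ?\<sigma> = real N * ?\<phi> ?c"
  proof -
    have "potential ?G ?\<phi> ?\<sigma> = (\<Sum>v\<in>nonsink ?G. if v = ?c then real N * ?\<phi> ?c else 0)"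
      unfolding potential_def by (intro sum.cong) (auto simp: count_list_replicate)
    then show ?thesis using c by (simp add: nonsink_grid finite_cells)
  qed
  ultimately have pot: "potential ?G ?\<phi> ?\<sigma> < 1 / 10000" using N by linarith
  have "set ?vs \<subseteq> nonsink ?G" using c by auto
  then obtain \<tau> where \<tau>: "adds ?G (\<lambda>_. 0) ?vs \<tau>"
    using adds_exists[OF terminating_grid] by blast
  have slow: "potential ?G ?\<phi> ?\<sigma> < laplacian ?G ?\<phi> v"
    if "v \<in> nonsink ?G" "mult ?G v ?a \<noteq> 0 \<or> mult ?G v ?b \<noteq> 0" for v
    using corner[OF that] pot by linarith
  note blocked = zero_if_neighbours_blocked[OF grid_wf nonneg superharmonic _ adds_topple_steps[OF \<tau>]]
  have "\<tau> ?a = 0"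
    by (rule blocked) (use slow n in \<open>simp_all add: count_list_replicate\<close>)
  moreover have "\<tau> ?b = 0"
    by (rule blocked) (use slow n in \<open>simp_all add: count_list_replicate\<close>)
  ultimately have "\<not> recurrent ?G \<tau>"
    by (rule not_recurrent_if_adjacent_zeros[OF grid_wf grid_connected ab, rotated -2])
  moreover have "is_config ?G \<tau> \<and> stable ?G \<tau>"
    by (rule adds_invariants[OF \<tau> _ zero]) (simp add: is_config_def)
  ultimately have "transient ?G \<tau>" by (simp add: transient_def)
  from le_tclI[OF grid_wf terminating_grid \<tau> this zero] show ?thesis by simp
qed

theorem mainTheorem2:
  "(\<lambda>n. real (tcl (grid n))) \<in> \<Omega>(\<lambda>n. real n ^ 4)"
proof (rule landau_omega.bigI)
  show "\<forall>\<^sub>F n in sequentially. norm (real (tcl (grid n))) \<ge> 1 / 640000 * norm (real n ^ 4)"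
  proof (rule eventually_sequentiallyI)
    fix n :: nat assume n: "100 \<le> n"
    \<comment> \<open>320000 = 32 * 10000. Halving the constant afterwards absorbs the floor, as n^4
      / 640000 >= 1 for n >= 100.\<close>
    define N where "N = nat \<lfloor>real n ^ 4 / 320000\<rfloor>"
    have "real N \<le> real n ^ 4 / 320000" unfolding N_def by (rule of_nat_floor) simp
    also have "\<dots> < (real n + 1) ^ 4 / 320000"
      by (intro divide_strict_right_mono power_strict_mono) auto
    finally have "real N * (32 / (real n + 1) ^ 4) < 1 / 10000"
      by (simp add: field_simps)
    then have "N \<le> tcl (grid n)" using n by (intro le_tcl_grid) auto
    moreover have "real n ^ 4 / 640000 \<le> real N"
    proof -
      have "real n ^ 4 \<ge> 100 ^ 4" using n by (intro power_mono) auto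
      moreover have "x < real (nat \<lfloor>x\<rfloor>) + 1" for x :: real by linarith
      from this[of "real n ^ 4 / 320000"] have "real n ^ 4 / 320000 < real N + 1"
        by (simp add: N_def)
      ultimately show ?thesis by simp
    qed
    ultimately show "norm (real (tcl (grid n))) \<ge> 1 / 640000 * norm (real n ^ 4)" by simp
  qed
qed simp

end
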